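(* If $(Q,t)$ is an equilibrium, then $t(n)$ (on $[0,N]$) and its inverse $n(t)$ (on the set of arrival times) are strictly increasing functions.
   Context: $N>0$ (mass of travelers) and $s>0$ (bottleneck capacity) are real numbers. Travelers are indexed by $n\in[0,N]$. $\beta:[0,N]\to(0,1)$ is continuous and strictly increasing (earliness penalty), and $\gamma:[0,N]\to(0,\infty)$ is continuous and strictly decreasing (lateness penalty). Time is measured relative to the preferred arrival time $0$, and $\mathcal{T}=[-N/s,N/s]$. Write $[x]^+=\max\{x,0\}$. A (feasible) solution is a pair $(Q,t)$, where $Q:\mathcal{T}\to[0,\infty)$ is the queueing delay profile ($Q(t)$ is the queueing delay of a traveler arriving at time $t$) and $t:[0,N]\to\mathcal{T}$ is injective and measurable ($t(n)$ is the arrival time of traveler $n$), with inverse function $n(\cdot)$ defined on the set of arrival times, such that: (i) the support $\{t\in\mathcal{T}:Q(t)>0\}$ has total width (Lebesgue measure) at most $N/s$; (ii) (first-in, first-out) $Q(t_2)-Q(t_1)<t_2-t_1$ for all $t_1<t_2$ in $\mathcal{T}$ (in particular $Q$ has no positive jumps; negative jumps are allowed); (iii) (bottleneck of capacity $s$, discharging at capacity whenever the queue is active) for every interval $I\subseteq\mathcal{T}$ of length $\ell$, the Lebesgue measure of $\{n:t(n)\in I\}$ is at most $s\ell$, and it equals $s\ell$ if $Q>0$ throughout $I$; moreover every time $t$ with $Q(t)>0$ is the arrival time of some traveler $n(t)$. The cost of traveler $n$ when arriving at time $t$ is $C_n(t)=Q(t)+\beta(n)[-t]^+ +\gamma(n)[t]^+$.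 A feasible pair $(Q,t)$ is an equilibrium if $C_n(t(n))=\min_{u\in\mathcal{T}}C_n(u)$ for all $n\in[0,N]$. *)

theory Defs
  imports "HOL-Analysis.Analysis"
begin

text \<open>
  Functions on \<open>[0,N]\<close> or on the time horizon are total functions on the reals of which only
  the values on the respective interval matter.
\<close>

definition horizon :: "real \<Rightarrow> real \<Rightarrow> real set" where
  "horizon N s = {- (N / s) .. N / s}"

definition pos_part :: "real \<Rightarrow> real" where
  "pos_part x = max x 0"

text \<open>
  In the support condition the set is always measurable: by the FIFO condition,
  \<open>Q u - u\<close> is decreasing on the horizon.  The capacity condition ranges over all intervals
  (open, closed, half-open, degenerate), whose length is their Lebesgue measure.
\<close>

definition feasible ::
    "real \<Rightarrow> real \<Rightarrow> (real \<Rightarrow> real) \<Rightarrow> (real \<Rightarrow> real) \<Rightarrow> bool" where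
  "feasible N s Q t \<longleftrightarrow>
     (\<forall>u \<in> horizon N s. 0 \<le> Q u) \<and>
     t \<in> {0..N} \<rightarrow> horizon N s \<and>
     inj_on t {0..N} \<and>
     t \<in> borel_measurable (lebesgue_on {0..N}) \<and>
     measure lebesgue {u \<in> horizon N s. 0 < Q u} \<le> N / s \<and>
     (\<forall>u1 \<in> horizon N s. \<forall>u2 \<in> horizon N s. u1 < u2 \<longrightarrow> Q u2 - Q u1 < u2 - u1) \<and>
     (\<forall>I. is_interval I \<and> I \<subseteq> horizon N s \<longrightarrow>
        measure lebesgue {n \<in> {0..N}. t n \<in> I} \<le> s * measure lebesgue I \<and>
        ((\<forall>u \<in> I. 0 < Q u) \<longrightarrow>
           measure lebesgue {n \<in> {0..N}. t n \<in> I} = s * measure lebesgue I)) \<and>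
     (\<forall>u \<in> horizon N s. 0 < Q u \<longrightarrow> u \<in> t ` {0..N})"

definition cost ::
    "(real \<Rightarrow> real) \<Rightarrow> (real \<Rightarrow> real) \<Rightarrow> (real \<Rightarrow> real) \<Rightarrow> real \<Rightarrow> real \<Rightarrow> real" where
  "cost \<beta> \<gamma> Q n u = Q u + \<beta> n * pos_part (- u) + \<gamma> n * pos_part u"

definition equilibrium ::
    "real \<Rightarrow> real \<Rightarrow> (real \<Rightarrow> real) \<Rightarrow> (real \<Rightarrow> real) \<Rightarrow>
     (real \<Rightarrow> real) \<Rightarrow> (real \<Rightarrow> real) \<Rightarrow> bool" where
  "equilibrium N s \<beta> \<gamma> Q t \<longleftrightarrow>
     feasible N s Q t \<and>
     (\<forall>n \<in> {0..N}. is_arg_min (cost \<beta> \<gamma> Q n) (\<lambda>u. u \<in> horizon N s) (t n))"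

end

theory Submission
  imports Defs
begin

text \<open>
  Revealed preference: add the equilibrium inequalities of two travelers \<open>m < n\<close>, each comparing
  their own arrival time with the other's.  The queueing delays cancel, and what remains,
  \<open>(\<beta> n - \<beta> m) * ([- b]\<^sup>+ - [- a]\<^sup>+) + (\<gamma> m - \<gamma> n) * ([a]\<^sup>+ - [b]\<^sup>+) \<le> 0\<close> for \<open>a = t m\<close> and
  \<open>b = t n\<close>, fails if \<open>b < a\<close>.
\<close>

text \<open>Since \<open>x = pos_part x - pos_part (- x)\<close>, the two parts cannot both stay put
  when \<open>x\<close> grows. Times on the same side of 0 change only one of them, hence the
  disjunction.\<close>

lemma less_imp_pos_part_less:
  assumes "b < a"
  shows "pos_part b < pos_part a \<or> pos_part (- a) < pos_part (- b)"
  using assms by (auto simp: pos_part_def max_def)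

lemma pos_part_mono: "b \<le> a \<Longrightarrow> pos_part b \<le> pos_part a"
  by (simp add: pos_part_def max_def)

lemma cost_exchange_imp_le:
  assumes "\<beta> m < \<beta> n" and "\<gamma> n < \<gamma> m"
    and m: "cost \<beta> \<gamma> Q m a \<le> cost \<beta> \<gamma> Q m b"
    and n: "cost \<beta> \<gamma> Q n b \<le> cost \<beta> \<gamma> Q n a"
  shows "a \<le> b"
proof (rule ccontr)
  assume "\<not> a \<le> b"
  then have "b < a" by simp
  let ?x = "(\<beta> n - \<beta> m) * (pos_part (- b) - pos_part (- a))"
  let ?y = "(\<gamma> m - \<gamma> n) * (pos_part a - pos_part b)"
  have "?x + ?y \<le> 0"
    using m n by (simp add: cost_def algebra_simps)
  moreover have "0 \<le> ?x" "0 \<le> ?y"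
    using assms \<open>b < a\<close> by (simp_all add: pos_part_mono)
  \<comment> \<open>\<open>?x\<close> is positive if \<open>b\<close> is early, \<open>?y\<close> if
    \<open>a\<close> is late.\<close>
  moreover have "0 < ?x \<or> 0 < ?y"
    using assms less_imp_pos_part_less[OF \<open>b < a\<close>] by (auto intro: mult_pos_pos)
  ultimately show False by linarith
qed

text \<open>On a linear order a strictly increasing map also reflects \<open><\<close>.\<close>

lemma strict_mono_on_the_inv_into:
  fixes f :: "'a::linorder \<Rightarrow> 'b::linorder"
  assumes "strict_mono_on A f"
  shows "strict_mono_on (f ` A) (the_inv_into A f)"
  using assms strict_mono_on_less[OF assms]
  by (auto intro!: strict_mono_onI
      simp: the_inv_into_f_f strict_mono_on_imp_inj_on)

theorem lemma3:
  fixes N s :: real and \<beta> \<gamma> Q t :: "real \<Rightarrow> real"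
  assumes "N > 0" and "s > 0"
    and "\<beta> \<in> {0..N} \<rightarrow> {0<..<1}"
    and "continuous_on {0..N} \<beta>"
    and "strict_mono_on {0..N} \<beta>"
    and "\<gamma> \<in> {0..N} \<rightarrow> {0<..}"
    and "continuous_on {0..N} \<gamma>"
    and "strict_antimono_on {0..N} \<gamma>"
    and "equilibrium N s \<beta> \<gamma> Q t"
  shows "strict_mono_on {0..N} t \<and>
         strict_mono_on (t ` {0..N}) (the_inv_into {0..N} t)"
proof -
  have inj: "inj_on t {0..N}" and hor: "t \<in> {0..N} \<rightarrow> horizon N s"
    using assms(9) by (auto simp: equilibrium_def feasible_def)
  have opt: "cost \<beta> \<gamma> Q n (t n) \<le> cost \<beta> \<gamma> Q n (t m)" if "n \<in> {0..N}" "m \<in> {0..N}" for m n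
    using assms(9) hor that by (auto simp: equilibrium_def is_arg_min_linorder Pi_iff)
  have "strict_mono_on {0..N} t"
  proof (rule strict_mono_onI)
    fix m n assume mn: "m \<in> {0..N}" "n \<in> {0..N}" "m < n"
    have "\<beta> m < \<beta> n" "\<gamma> n < \<gamma> m"
      using assms(5,8) mn by (auto simp: monotone_on_def)
    then have "t m \<le> t n"
      using opt mn by (blast intro: cost_exchange_imp_le)
    \<comment> \<open>The exchange argument allows equal arrival times, where both cost inequalities
      are trivial; injectivity of \<open>t\<close> excludes them.\<close>
    moreover have "t m \<noteq> t n"
      using inj mn by (auto dest: inj_onD)
    ultimately show "t m < t n" by simp
  qed
  then show ?thesis
    by (simp add: strict_mono_on_the_inv_into)
qed

end
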